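(* For every integer $k\ge2$, the polynomial $\widetilde{\Delta}_{3k,3}(C)$ has no roots in $\mathbb{Q}^{\mathrm{ab}}$, the maximal abelian extension of $\mathbb{Q}$.
   Context: Let $f_c(z)=z^2+c$, with iterates $f_c^{\circ 0}(z)=z$, $f_c^{\circ j}=f_c\circ f_c^{\circ(j-1)}$. For $n\ge1$ let $\Phi_n^*(z,c)=\prod_{j\mid n}(f_c^{\circ j}(z)-z)^{\mu(n/j)}$, and let $\delta_n(x,c)$ be the polynomial, monic in $x$, with $\delta_n(x,c)^n=\operatorname{Res}_z(\Phi_n^*(z,c),x-(f_c^{\circ n})'(z))$ (it lies in $\mathbb{Z}[x,4c]$ and is monic in $4c$). Let $\Psi_j$ be the $j$-th cyclotomic polynomial. For $m\mid n$, $m<n$, set $\Delta_{n,m}(c)=\operatorname{Res}_x(\Psi_{n/m}(x),\delta_m(x,c))$ and $\widetilde{\Delta}_{n,m}(C)=\Delta_{n,m}(C/4)\in\mathbb{Z}[C]$. Explicitly $\delta_3(x,C/4)=x^2-(2C+16)x+(C^3+8C^2+16C+64)$, so $\widetilde\Delta_{3k,3}(C)=\operatorname{Res}_x(\Psi_k(x),x^2-(2C+16)x+C^3+8C^2+16C+64)$. *)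

theory Defs
  imports Complex_Main "HOL-Computational_Algebra.Polynomial" "Subresultants.Resultant_Prelim"
begin

definition cyclo_poly :: "nat \<Rightarrow> complex poly" where
  "cyclo_poly k = (\<Prod>j\<in>{j. 1 \<le> j \<and> j \<le> k \<and> coprime j k}.
                      [:- cis (2 * pi * real j / real k), 1:])"

(* delta_3(x, C/4) = x^2 - (2C+16) x + (C^3+8C^2+16C+64), as a polynomial in x
   whose coefficients are polynomials in C *)
definition delta3 :: "complex poly poly" where
  "delta3 = [: [:64, 16, 8, 1:], [:-16, -2:], 1 :]"

definition Delta_tilde :: "nat \<Rightarrow> complex poly" where
  "Delta_tilde k = resultant (map_poly (\<lambda>a. [:a:]) (cyclo_poly k)) delta3"

definition field_aut :: "complex set \<Rightarrow> (complex \<Rightarrow> complex) \<Rightarrow> bool" where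
  "field_aut K \<sigma> \<longleftrightarrow> bij_betw \<sigma> K K \<and> \<sigma> 1 = 1 \<and>
     (\<forall>x\<in>K. \<forall>y\<in>K. \<sigma> (x + y) = \<sigma> x + \<sigma> y \<and> \<sigma> (x * y) = \<sigma> x * \<sigma> y)"

definition is_subfield :: "complex set \<Rightarrow> bool" where
  "is_subfield K \<longleftrightarrow> 0 \<in> K \<and> 1 \<in> K \<and>
     (\<forall>x\<in>K. \<forall>y\<in>K. x + y \<in> K \<and> x - y \<in> K \<and> x * y \<in> K) \<and>
     (\<forall>x\<in>K. x \<noteq> 0 \<longrightarrow> inverse x \<in> K)"

definition finite_abelian_ext :: "complex set \<Rightarrow> bool" where
  "finite_abelian_ext K \<longleftrightarrow> is_subfield K \<and>
     (\<exists>B. finite B \<and> B \<subseteq> K \<and> K = {\<Sum>b\<in>B. of_rat (c b) * b | c. True}) \<and>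
     (\<forall>p :: rat poly. irreducible p \<and> (\<exists>x\<in>K. poly (map_poly of_rat p) x = 0) \<longrightarrow>
        (\<forall>x. poly (map_poly of_rat p) x = 0 \<longrightarrow> x \<in> K)) \<and>
     (\<forall>\<sigma> \<tau>. field_aut K \<sigma> \<and> field_aut K \<tau> \<longrightarrow> (\<forall>x\<in>K. \<sigma> (\<tau> x) = \<tau> (\<sigma> x)))"

definition Qab :: "complex set" where
  "Qab = {z. \<exists>K. finite_abelian_ext K \<and> z \<in> K}"

end

theory Submission
  imports Defs "Subresultants.Subresultant_Gcd" "Jordan_Normal_Form.Char_Poly"
    "HOL-Computational_Algebra.Field_as_Ring"
    "HOL-Computational_Algebra.Fundamental_Theorem_Algebra"
begin

text \<open>
  The curve \<open>delta3(x, C) = 0\<close> is parametrized by \<open>C = -7 - t\<^sup>2\<close>, \<open>x = g(t) = t\<^sup>3 - t\<^sup>2 + 7 t + 1\<close>.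
  Suppose \<open>C\<close> lies in an abelian field \<open>K\<close> and \<open>x\<close> is a root of unity different from 1; then \<open>t\<close> lies
  in \<open>K\<close> as well. Complex conjugation commutes with the automorphisms of \<open>K\<close>, so the conjugates of
  \<open>a = t (t + cnj t - 1)\<close> are the values \<open>s (s + cnj s - 1)\<close> at the conjugates \<open>s\<close> of \<open>t\<close>, all of
  which satisfy \<open>|g(s)| = 1\<close>. On that curve \<open>|s (s + cnj s - 1)| < 1\<close>: either \<open>s\<close> is near 0, or near one of the
  roots of \<open>s\<^sup>2 - s + 7\<close>, which have real part 1/2. As \<open>a\<close> is an algebraic integer,
  \<open>a = 0\<close>, hence \<open>t + cnj t = 1\<close>. The same argument applied to \<open>7 - t cnj t\<close> gives a contradiction.
\<close>

subsection \<open>Algebraic integers\<close>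

text \<open>The vector \<open>v\<close> is an eigenvector of the matrix \<open>h M\<close> for the
  eigenvalue \<open>x\<close>, so \<open>x\<close> is a root of its characteristic polynomial, which
  is monic. With \<open>h\<close> left general, this serves both integer matrices (algebraic
  integers) and rational ones (elements of a finite extension).\<close>

lemma linear_system_imp_monic_root:
  fixes h :: "'a :: comm_ring_1 \<Rightarrow> complex" and v :: "'i \<Rightarrow> complex"
  assumes h: "comm_ring_hom h" and fin: "finite I" and nz: "i0 \<in> I" "v i0 \<noteq> 0"
    and sys: "\<And>i. i \<in> I \<Longrightarrow> x * v i = (\<Sum>j\<in>I. h (M i j) * v j)"
  obtains p where "lead_coeff p = 1" "poly (map_poly h p) x = 0"
proof -
  interpret h: comm_ring_hom h by fact
  define n where "n = card I"
  obtain e where e: "bij_betw e {..<n} I"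
    unfolding n_def using ex_bij_betw_nat_finite[OF fin] by (auto simp: atLeast0LessThan)
  define A where "A = mat n n (\<lambda>(i, j). M (e i) (e j))"
  define w where "w = vec n (\<lambda>i. v (e i))"
  have A: "A \<in> carrier_mat n n" by (simp add: A_def)
  have hA: "map_mat h A \<in> carrier_mat n n" using A by simp
  have "map_mat h A *\<^sub>v w = x \<cdot>\<^sub>v w"
  proof (rule eq_vecI)
    fix i assume "i < dim_vec (x \<cdot>\<^sub>v w)"
    then have i: "i < n" by (simp add: w_def)
    then have ei: "e i \<in> I" using e by (auto simp: bij_betw_def)
    have "(map_mat h A *\<^sub>v w) $ i = (\<Sum>j<n. h (M (e i) (e j)) * v (e j))"
      using i by (simp add: A_def w_def scalar_prod_def atLeast0LessThan)
    also have "\<dots> = (\<Sum>j\<in>I. h (M (e i) j) * v j)"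
      by (rule sum.reindex_bij_betw[OF e])
    also have "\<dots> = x * v (e i)" using sys[OF ei] by simp
    finally show "(map_mat h A *\<^sub>v w) $ i = (x \<cdot>\<^sub>v w) $ i" using i by (simp add: w_def)
  qed (simp add: A_def w_def)
  moreover have "w \<noteq> 0\<^sub>v n"
  proof
    assume w0: "w = 0\<^sub>v n"
    obtain i where "i < n" "e i = i0" using e nz by (auto simp: bij_betw_def)
    then have "v i0 = w $ i" by (simp add: w_def)
    then show False using w0 \<open>i < n\<close> nz by simp
  qed
  ultimately have "eigenvector (map_mat h A) w x"
    by (simp add: eigenvector_def w_def A_def)
  then have "poly (char_poly (map_mat h A)) x = 0"
    using eigenvalue_root_char_poly[OF hA] unfolding eigenvalue_def by blast
  then have "poly (map_poly h (char_poly A)) x = 0"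
    by (simp add: h.char_poly_hom[OF A])
  moreover have "lead_coeff (char_poly A) = 1" using degree_monic_char_poly[OF A] by simp
  ultimately show ?thesis using that by blast
qed

text \<open>\<open>M\<close> is the companion matrix of a monic integer polynomial with root
  \<open>x\<close>, acting on the powers \<open>x ^ 0, ..., x ^ (d - 1)\<close>.\<close>

lemma algebraic_int_companion:
  fixes x :: complex
  assumes "algebraic_int x"
  obtains d :: nat and M :: "nat \<Rightarrow> nat \<Rightarrow> int"
  where "d > 0" "\<And>i. i < d \<Longrightarrow> x * x ^ i = (\<Sum>j<d. of_int (M i j) * x ^ j)"
proof -
  obtain p where p: "poly (map_poly of_int p) x = 0" "lead_coeff p = 1"
    using assms unfolding algebraic_int_altdef_ipoly by blast
  define d where "d = degree p"
  have d0: "d > 0"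
  proof (rule ccontr)
    assume "\<not> d > 0"
    then obtain c where "p = [:c:]" by (auto simp: d_def elim: degree_eq_zeroE)
    then show False using p by simp
  qed
  define M where "M i j = (if Suc i < d then (if j = Suc i then 1 else 0) else - coeff p j)" for i j
  have "0 = (\<Sum>j\<le>d. of_int (coeff p j) * x ^ j)"
    using p(1) by (simp add: poly_altdef d_def)
  also have "\<dots> = (\<Sum>j<d. of_int (coeff p j) * x ^ j) + x ^ d"
    using p(2) by (simp add: d_def lessThan_Suc_atMost[symmetric])
  finally have xd: "x ^ d = (\<Sum>j<d. of_int (- coeff p j) * x ^ j)"
    by (simp add: sum_negf eq_neg_iff_add_eq_0 add.commute)
  have "x * x ^ i = (\<Sum>j<d. of_int (M i j) * x ^ j)" if "i < d" for i
  proof (cases "Suc i < d")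
    case True
    then have "(\<Sum>j<d. of_int (M i j) * x ^ j) = (\<Sum>j<d. if j = Suc i then x ^ j else 0)"
      by (intro sum.cong) (auto simp: M_def)
    also have "\<dots> = x ^ Suc i" using True by (simp add: sum.delta)
    finally show ?thesis by simp
  next
    case False
    with that have "Suc i = d" by simp
    then have "x * x ^ i = x ^ d" by (metis power_Suc)
    then show ?thesis using xd False by (simp add: M_def)
  qed
  with d0 that show ?thesis by blast
qed

text \<open>The products \<open>x ^ i * y ^ j\<close> form a common eigenvector: of the Kronecker
  product of the two companion matrices for \<open>x * y\<close>, and of \<open>M\<close> tensor 1
  plus 1 tensor \<open>N\<close> for \<open>x + y\<close>. Here \<open>?D\<close> is the identity
  matrix.\<close>

lemma
  fixes x y :: complex
  assumes "algebraic_int x" "algebraic_int y"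
  shows algebraic_int_plus: "algebraic_int (x + y)"
    and algebraic_int_times: "algebraic_int (x * y)"
proof -
  obtain d M where d: "d > 0" "\<And>i. i < d \<Longrightarrow> x * x ^ i = (\<Sum>j<d. of_int (M i j) * x ^ j)"
    using algebraic_int_companion[OF assms(1)] by metis
  obtain e N where e: "e > 0" "\<And>i. i < e \<Longrightarrow> y * y ^ i = (\<Sum>j<e. of_int (N i j) * y ^ j)"
    using algebraic_int_companion[OF assms(2)] by metis
  let ?I = "{..<d} \<times> {..<e}" and ?v = "\<lambda>(i, j). x ^ i * y ^ j"
  let ?D = "\<lambda>i j :: nat. if i = j then 1 else 0 :: int"
  have hom: "comm_ring_hom (of_int :: int \<Rightarrow> complex)" by unfold_locales
  have nz: "(0, 0) \<in> ?I" "?v (0, 0) \<noteq> 0" using d(1) e(1) by auto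
  have delta: "x ^ i = (\<Sum>j<d. of_int (?D i j) * x ^ j)" if "i < d" for i
    using that by (simp add: if_distrib[of "\<lambda>c. of_int c * _"] sum.delta cong: if_cong)
  have delta': "y ^ i = (\<Sum>j<e. of_int (?D i j) * y ^ j)" if "i < e" for i
    using that by (simp add: if_distrib[of "\<lambda>c. of_int c * _"] sum.delta cong: if_cong)
  have prod: "(\<Sum>a<d. of_int (f a) * x ^ a) * (\<Sum>b<e. of_int (g b) * y ^ b)
      = (\<Sum>(a, b)\<in>?I. of_int (f a * g b) * (x ^ a * y ^ b))" for f g :: "nat \<Rightarrow> int"
    by (simp add: sum_product sum.cartesian_product mult_ac split_def)
  show "algebraic_int (x * y)"
  proof (rule linear_system_imp_monic_root[where v = ?v, OF hom _ nz])
    fix k assume "k \<in> ?I"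
    then obtain i j where k: "k = (i, j)" "i < d" "j < e" by auto
    have "x * y * ?v k = (x * x ^ i) * (y * y ^ j)" by (simp add: k)
    also have "\<dots> = (\<Sum>(a, b)\<in>?I. of_int (M i a * N j b) * (x ^ a * y ^ b))"
      unfolding d(2)[OF k(2)] e(2)[OF k(3)] by (rule prod)
    finally show "x * y * ?v k = (\<Sum>l\<in>?I. of_int (M (fst k) (fst l) * N (snd k) (snd l)) * ?v l)"
      by (simp add: split_def k)
  qed (auto simp: algebraic_int_altdef_ipoly)
  show "algebraic_int (x + y)"
  proof (rule linear_system_imp_monic_root[where v = ?v, OF hom _ nz])
    fix k assume "k \<in> ?I"
    then obtain i j where k: "k = (i, j)" "i < d" "j < e" by auto
    have "(x + y) * ?v k = (x * x ^ i) * y ^ j + x ^ i * (y * y ^ j)" by (simp add: k algebra_simps)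
    also have "(x * x ^ i) * y ^ j = (\<Sum>(a, b)\<in>?I. of_int (M i a * ?D j b) * (x ^ a * y ^ b))"
      unfolding d(2)[OF k(2)] by (subst delta'[OF k(3)]) (rule prod)
    also have "x ^ i * (y * y ^ j) = (\<Sum>(a, b)\<in>?I. of_int (?D i a * N j b) * (x ^ a * y ^ b))"
      unfolding e(2)[OF k(3)] by (subst delta[OF k(2)]) (rule prod)
    finally show "(x + y) * ?v k = (\<Sum>l\<in>?I. of_int (M (fst k) (fst l) * ?D (snd k) (snd l)
        + ?D (fst k) (fst l) * N (snd k) (snd l)) * ?v l)"
      by (simp only: split_def k fst_conv snd_conv of_int_add distrib_right sum.distrib)
  qed (auto simp: algebraic_int_altdef_ipoly)
qed

lemma algebraic_int_diff:
  fixes x y :: complex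
  assumes "algebraic_int x" "algebraic_int y"
  shows "algebraic_int (x - y)"
  using algebraic_int_plus[OF assms(1) algebraic_int_minus[OF assms(2)]] by simp

lemma algebraic_int_of_root_of_unity:
  fixes x :: complex
  assumes "x ^ k = 1" "k > 0"
  shows "algebraic_int x"
proof (rule algebraic_int_root[of 1 "monom 1 k"])
  show "poly (monom 1 k) x = 1" using assms(1) by (simp add: poly_monom)
  show "\<forall>i. coeff (monom 1 k :: complex poly) i \<in> \<int>" by simp
  show "lead_coeff (monom 1 k :: complex poly) = 1" by (simp add: degree_monom_eq)
  show "degree (monom 1 k :: complex poly) > 0" using assms(2) by (simp add: degree_monom_eq)
qed (rule int_imp_algebraic_int, simp)

subsection \<open>Rational polynomials and simple extensions\<close>

abbreviation rpoly :: "rat poly \<Rightarrow> complex \<Rightarrow> complex" where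
  "rpoly p x \<equiv> poly (map_poly of_rat p) x"

interpretation of_rat_poly_hom: map_poly_inj_idom_hom "of_rat :: rat \<Rightarrow> complex" ..

lemma rpoly_simps [simp]:
  "rpoly (p + q) x = rpoly p x + rpoly q x"
  "rpoly (p - q) x = rpoly p x - rpoly q x"
  "rpoly (- p) x = - rpoly p x"
  "rpoly (p * q) x = rpoly p x * rpoly q x"
  "rpoly (smult c p) x = of_rat c * rpoly p x"
proof -
  show "rpoly (p + q) x = rpoly p x + rpoly q x"
    unfolding of_rat_poly_hom.hom_add by (rule poly_add)
  show "rpoly (p - q) x = rpoly p x - rpoly q x"
    unfolding of_rat_poly_hom.hom_minus by (rule poly_diff)
  show "rpoly (- p) x = - rpoly p x"
    unfolding of_rat_poly_hom.hom_uminus by (rule poly_minus)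
  show "rpoly (p * q) x = rpoly p x * rpoly q x"
    unfolding of_rat_poly_hom.hom_mult by (rule poly_mult)
  show "rpoly (smult c p) x = of_rat c * rpoly p x"
    unfolding of_rat_hom.map_poly_hom_smult by (rule poly_smult)
qed

text \<open>An annihilator of least degree is irreducible: in a factorization one factor vanishes at
  \<open>x\<close>, so it already has the full degree and the other factor is constant.\<close>

lemma irreducible_annihilator:
  assumes "q \<noteq> 0" "rpoly q x = 0"
  obtains p where "irreducible p" "rpoly p x = 0"
proof -
  obtain p where p: "p \<noteq> 0" "rpoly p x = 0"
    and min: "\<And>r. r \<noteq> 0 \<Longrightarrow> rpoly r x = 0 \<Longrightarrow> degree p \<le> degree r"
    using ex_has_least_nat[of "\<lambda>r. r \<noteq> 0 \<and> rpoly r x = 0" q degree] assms by blast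
  have "irreducible p"
  proof (rule irreducibleI)
    show "\<not> p dvd 1"
    proof
      assume "p dvd 1"
      then obtain r where "1 = p * r" ..
      then have "rpoly (p * r) x = rpoly 1 x" by metis
      then show False using p by simp
    qed
    fix a b assume ab: "p = a * b"
    then have nz: "a \<noteq> 0" "b \<noteq> 0" and d: "degree p = degree a + degree b"
      using p by (auto simp: degree_mult_eq)
    from ab p have "rpoly a x = 0 \<or> rpoly b x = 0" by simp
    then have "degree b = 0 \<or> degree a = 0"
      using min[of a] min[of b] nz d by auto
    then show "a dvd 1 \<or> b dvd 1" using nz by (auto simp: is_unit_iff_degree)
  qed (use p in auto)
  with p that show ?thesis by blast
qed

lemma irreducible_bezout:
  fixes p q :: "rat poly"
  assumes "irreducible p" "\<not> p dvd q"
  obtains u v where "u * p + v * q = 1"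
proof -
  have "prime_elem p" using assms(1) by (rule field_poly_irreducible_imp_prime)
  then have "coprime p q" using assms(2) by (rule prime_elem_imp_coprime)
  then have "gcd p q = 1" by (simp add: coprime_iff_gcd_eq_1)
  then show ?thesis using bezout_coefficients_fst_snd[of p q] that by metis
qed

lemma irreducible_dvd_of_root:
  assumes "irreducible p" "rpoly p x = 0" "rpoly q x = 0"
  shows "p dvd q"
proof (rule ccontr)
  assume "\<not> p dvd q"
  then obtain u v where "u * p + v * q = 1" using irreducible_bezout assms(1) by blast
  then have "rpoly (u * p + v * q) x = rpoly 1 x" by simp
  then show False using assms by simp
qed

lemma irreducible_degree_pos:
  fixes p :: "rat poly"
  assumes "irreducible p"
  shows "degree p > 0"
proof (rule ccontr)
  assume "\<not> degree p > 0"
  moreover have "p \<noteq> 0" using assms by auto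
  ultimately have "p dvd 1" using is_unit_iff_degree[of p] by blast
  then show False using assms irreducible_not_unit by blast
qed

text \<open>In characteristic zero the derivative is nonzero of lower degree, so \<open>p\<close>
  does not divide it; the Bezout identity over the rationals then rules out a common complex
  root.\<close>

lemma irreducible_rsquarefree:
  fixes p :: "rat poly"
  assumes "irreducible p"
  shows "rsquarefree (map_poly of_rat p :: complex poly)"
  unfolding rsquarefree_roots
proof (intro allI notI)
  fix a :: complex
  assume a: "rpoly p a = 0 \<and> poly (pderiv (map_poly of_rat p)) a = 0"
  have "\<not> p dvd pderiv p" using irreducible_degree_pos[OF assms] by simp
  then obtain u v where "u * p + v * pderiv p = 1" using irreducible_bezout assms by blast
  then have "rpoly (u * p + v * pderiv p) a = rpoly 1 a" by simp
  moreover have "rpoly (pderiv p) a = 0" using a by (simp add: of_rat_hom.map_poly_pderiv)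
  ultimately show False using a by simp
qed

section \<open>Simple extensions and subfields of the complex numbers\<close>

definition adjoin :: "complex \<Rightarrow> complex set" where
  "adjoin \<theta> = range (\<lambda>p. rpoly p \<theta>)"

text \<open>\<open>adjoin \<theta>\<close> is in general only a ring. For algebraic
  \<open>\<theta>\<close>, a Bezout identity between \<open>p\<close> and a polynomial
  \<open>a\<close> not divisible by \<open>p\<close> exhibits the inverse of
  \<open>rpoly a \<theta>\<close> as a polynomial value.\<close>

lemma adjoin_subfield:
  assumes "irreducible p" "rpoly p \<theta> = 0"
  shows "is_subfield (adjoin \<theta>)"
proof -
  have "inverse (rpoly a \<theta>) \<in> adjoin \<theta>" if "rpoly a \<theta> \<noteq> 0" for a
  proof -
    have "\<not> p dvd a" using that assms(2) by (auto elim!: dvdE)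
    then obtain u v where "u * p + v * a = 1" using irreducible_bezout assms(1) by blast
    then have "rpoly (u * p + v * a) \<theta> = rpoly 1 \<theta>" by simp
    then have "rpoly v \<theta> * rpoly a \<theta> = 1" using assms(2) by simp
    then have "inverse (rpoly a \<theta>) = rpoly v \<theta>" using inverse_unique[of "rpoly a \<theta>" "rpoly v \<theta>"] by (simp add: mult.commute)
    then show ?thesis by (auto simp: adjoin_def)
  qed
  moreover have "0 \<in> adjoin \<theta>" "1 \<in> adjoin \<theta>"
    unfolding adjoin_def using rangeI[of "\<lambda>p. rpoly p \<theta>" 0] rangeI[of "\<lambda>p. rpoly p \<theta>" 1] by simp_all
  moreover have "rpoly a \<theta> + rpoly b \<theta> \<in> adjoin \<theta>" "rpoly a \<theta> - rpoly b \<theta> \<in> adjoin \<theta>" 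
    "rpoly a \<theta> * rpoly b \<theta> \<in> adjoin \<theta>" for a b
    unfolding adjoin_def by (auto simp flip: rpoly_simps)
  ultimately show ?thesis unfolding is_subfield_def adjoin_def by auto
qed

lemma rpoly_dvd: "p dvd q \<Longrightarrow> rpoly p x = 0 \<Longrightarrow> rpoly q x = 0"
  by (erule dvdE) (simp only: rpoly_simps mult_zero_left)

lemma subfieldD:
  assumes "is_subfield K"
  shows "0 \<in> K" "1 \<in> K" "x \<in> K \<Longrightarrow> y \<in> K \<Longrightarrow> x + y \<in> K" "x \<in> K \<Longrightarrow> y \<in> K \<Longrightarrow> x - y \<in> K"
    "x \<in> K \<Longrightarrow> y \<in> K \<Longrightarrow> x * y \<in> K" "x \<in> K \<Longrightarrow> - x \<in> K" "x \<in> K \<Longrightarrow> inverse x \<in> K"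
    "x \<in> K \<Longrightarrow> y \<in> K \<Longrightarrow> x / y \<in> K"
proof -
  show 0: "0 \<in> K" "1 \<in> K" using assms by (auto simp: is_subfield_def)
  show "x \<in> K \<Longrightarrow> y \<in> K \<Longrightarrow> x + y \<in> K" "x \<in> K \<Longrightarrow> y \<in> K \<Longrightarrow> x - y \<in> K"
    "x \<in> K \<Longrightarrow> y \<in> K \<Longrightarrow> x * y \<in> K" for x y using assms by (auto simp: is_subfield_def)
  show "x \<in> K \<Longrightarrow> - x \<in> K" using 0 assms by (metis diff_0 is_subfield_def)
  show inv: "x \<in> K \<Longrightarrow> inverse x \<in> K" for x using 0 assms by (cases "x = 0") (auto simp: is_subfield_def)
  show "x \<in> K \<Longrightarrow> y \<in> K \<Longrightarrow> x / y \<in> K" using inv[of y] assms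
    unfolding divide_inverse is_subfield_def by blast
qed

lemma subfield_of_rat:
  assumes K: "is_subfield K"
  shows "of_rat r \<in> K"
proof -
  have nat: "of_nat n \<in> K" for n
    by (induction n) (auto intro: subfieldD[OF K])
  have int: "of_int n \<in> K" for n
    by (cases n rule: int_cases2) (use nat subfieldD(6)[OF K] in auto)
  obtain a b where "r = of_int a / of_int b" by (metis quotient_of_div surj_pair)
  then show ?thesis using int subfieldD(8)[OF K] by (simp add: of_rat_divide)
qed

lemma subfield_power: "is_subfield K \<Longrightarrow> x \<in> K \<Longrightarrow> x ^ n \<in> K"
  by (induction n) (auto intro: subfieldD)

lemma subfield_numeral: "is_subfield K \<Longrightarrow> numeral n \<in> K"
  using subfield_of_rat[of K "numeral n"] by simp

lemma subfield_sum: "is_subfield K \<Longrightarrow> (\<And>i. i \<in> I \<Longrightarrow> f i \<in> K) \<Longrightarrow> sum f I \<in> K"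
  by (induction I rule: infinite_finite_induct) (auto intro: subfieldD)

lemma rpoly_pCons: "rpoly (pCons c p) x = of_rat c + x * rpoly p x"
  by (simp add: of_rat_hom.map_poly_pCons_hom)

lemma subfield_rpoly:
  assumes "is_subfield K" "x \<in> K"
  shows "rpoly p x \<in> K"
  by (induction p) (auto simp: rpoly_pCons simp del: map_poly_pCons intro!: subfieldD[OF assms(1)] subfield_of_rat assms)

lemma adjoin_subset: "is_subfield K \<Longrightarrow> x \<in> K \<Longrightarrow> adjoin x \<subseteq> K"
  by (auto simp: adjoin_def intro: subfield_rpoly)

lemma in_adjoin: "x \<in> adjoin x"
  unfolding adjoin_def by (rule range_eqI[of _ _ "[:0, 1:]"]) (simp add: rpoly_pCons)

lemma rpoly_pcompose: "rpoly (p \<circ>\<^sub>p q) x = rpoly p (rpoly q x)"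
  by (simp add: of_rat_hom.map_poly_pcompose poly_pcompose)

text \<open>Multiplication by \<open>x\<close> maps the span of \<open>B\<close> to itself, so it is
  described by a rational matrix. \<open>B\<close> may be linearly dependent; a nonzero element of
  it is enough to have an eigenvector.\<close>

lemma finite_span_algebraic:
  assumes K: "is_subfield K" and B: "finite B" "B \<subseteq> K" "K = {\<Sum>b\<in>B. of_rat (c b) * b | c. True}"
    and x: "x \<in> K"
  obtains p where "irreducible p" "rpoly p x = 0"
proof -
  obtain b0 where b0: "b0 \<in> B" "b0 \<noteq> 0"
  proof (rule ccontr)
    assume "\<not> thesis"
    then have z: "\<forall>b\<in>B. b = 0" using that by blast
    have "1 \<in> K" using subfieldD(2)[OF K] .
    then obtain c where "1 = (\<Sum>b\<in>B. of_rat (c b) * b)" using B(3) by blast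
    also have "\<dots> = 0" using z by (intro sum.neutral) auto
    finally show False by simp
  qed
  have "\<exists>c. x * b = (\<Sum>b'\<in>B. of_rat (c b') * b')" if "b \<in> B" for b
  proof -
    have "x * b \<in> K" using subfieldD(5)[OF K x] that B(2) by blast
    then show ?thesis using B(3) by blast
  qed
  then obtain M where M: "\<And>b. b \<in> B \<Longrightarrow> x * b = (\<Sum>b'\<in>B. of_rat (M b b') * b')" by metis
  have hom: "comm_ring_hom (of_rat :: rat \<Rightarrow> complex)" by unfold_locales
  obtain p where p: "lead_coeff p = 1" "rpoly p x = 0"
    by (rule linear_system_imp_monic_root[where v = "\<lambda>b. b", OF hom B(1) b0 M])
  from p(1) have "p \<noteq> 0" by auto
  then show ?thesis using p(2) that irreducible_annihilator by blast
qed

section \<open>Polynomials over a subfield and the primitive element theorem\<close>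

definition poly_over :: "complex set \<Rightarrow> complex poly \<Rightarrow> bool" where
  "poly_over S q \<longleftrightarrow> (\<forall>i. coeff q i \<in> S)"

lemma poly_over_rat: "is_subfield S \<Longrightarrow> poly_over S (map_poly of_rat p)"
  by (simp add: poly_over_def subfield_of_rat)

lemma poly_over_pCons_iff: "poly_over S (pCons c p) \<longleftrightarrow> c \<in> S \<and> poly_over S p"
proof
  assume h: "poly_over S (pCons c p)"
  have "coeff (pCons c p) 0 \<in> S" "\<And>i. coeff (pCons c p) (Suc i) \<in> S"
    using h unfolding poly_over_def by blast+
  then show "c \<in> S \<and> poly_over S p" by (simp add: poly_over_def)
qed (auto simp: poly_over_def coeff_pCons split: nat.split)

lemma poly_over_0: "is_subfield S \<Longrightarrow> poly_over S 0"
  by (simp add: poly_over_def subfieldD)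

lemma poly_over_add: "is_subfield S \<Longrightarrow> poly_over S p \<Longrightarrow> poly_over S q \<Longrightarrow> poly_over S (p + q)"
  by (simp add: poly_over_def subfieldD)

lemma poly_over_diff: "is_subfield S \<Longrightarrow> poly_over S p \<Longrightarrow> poly_over S q \<Longrightarrow> poly_over S (p - q)"
  by (simp add: poly_over_def subfieldD)

lemma poly_over_mult: "is_subfield S \<Longrightarrow> poly_over S p \<Longrightarrow> poly_over S q \<Longrightarrow> poly_over S (p * q)"
  unfolding poly_over_def coeff_mult by (auto intro!: subfield_sum subfieldD)

lemma poly_over_pcompose:
  assumes S: "is_subfield S" and "poly_over S p" and q: "poly_over S q"
  shows "poly_over S (p \<circ>\<^sub>p q)"
  using assms(2)
proof (induction p)
  case 0
  then show ?case using poly_over_0[OF S] by simp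
next
  case (pCons c p)
  then have "c \<in> S" "poly_over S p" by (auto simp: poly_over_pCons_iff)
  then show ?case using pCons.IH
    by (simp only: pcompose_pCons)
      (intro poly_over_add[OF S] poly_over_mult[OF S] q, auto simp: poly_over_pCons_iff poly_over_0[OF S])
qed

text \<open>This is division with remainder, carried out by hand because \<open>S\<close> is a set
  of numbers and not a type: cancelling the leading term of \<open>q\<close> by a multiple of
  \<open>m\<close> stays over \<open>S\<close>, keeps the root \<open>y\<close>, and lowers the
  degree or reaches 0.\<close>

lemma minimal_poly_over_dvd:
  assumes S: "is_subfield S"
    and m: "m \<noteq> 0" "poly_over S m" "poly m y = 0"
    and min: "\<And>r. r \<noteq> 0 \<Longrightarrow> poly_over S r \<Longrightarrow> poly r y = 0 \<Longrightarrow> degree m \<le> degree r"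
    and q: "poly_over S q" "poly q y = 0"
  shows "m dvd q"
  using q
proof (induction "degree q" arbitrary: q rule: less_induct)
  case less
  show ?case
  proof (cases "q = 0")
    case False
    then have le: "degree m \<le> degree q" using min less.prems by blast
    have dm: "degree m > 0"
    proof (rule ccontr)
      assume "\<not> degree m > 0"
      then obtain c where "m = [:c:]" by (auto elim: degree_eq_zeroE)
      then show False using m by simp
    qed
    define w where "w = monom (lead_coeff q / lead_coeff m) (degree q - degree m)"
    define r where "r = q - w * m"
    have "lead_coeff q / lead_coeff m \<in> S"
      using less.prems(1) m(2) subfieldD(8)[OF S] unfolding poly_over_def by blast
    then have "poly_over S w" using subfieldD(1)[OF S] by (simp add: w_def poly_over_def)
    then have rS: "poly_over S r" unfolding r_def
      using poly_over_diff[OF S less.prems(1) poly_over_mult[OF S _ m(2)]] by blast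
    have ry: "poly r y = 0" using less.prems m by (simp add: r_def)
    have "degree (w * m) \<le> degree q"
      using degree_mult_le[of w m] degree_monom_le[of "lead_coeff q / lead_coeff m" "degree q - degree m"] le
      unfolding w_def by linarith
    then have "degree r \<le> degree q" unfolding r_def by (intro degree_diff_le) auto
    moreover have "coeff r (degree q) = 0" using le m(1) by (simp add: r_def w_def coeff_monom_mult)
    ultimately have "r = 0 \<or> degree r < degree q" by (rule eq_zero_or_degree_less)
    then have "m dvd r" using less.hyps rS ry by auto
    then have "m dvd r + w * m" by simp
    then show ?thesis by (simp add: r_def)
  qed simp
qed

text \<open>The minimal polynomial \<open>m\<close> of \<open>y\<close> over
  \<open>adjoin \<gamma>\<close> divides both \<open>?H\<close> and \<open>?F\<close> composed with
  \<open>[:\<gamma>, - of_rat c:]\<close>. For a suitable \<open>c\<close> these share only the root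
  \<open>y\<close>, and \<open>?H\<close> has simple roots, so \<open>m\<close> is linear and its
  coefficients yield \<open>y\<close>.\<close>

lemma primitive_element_pair:
  assumes f: "irreducible f" "rpoly f x = 0" and h: "irreducible h" "rpoly h y = 0"
    and alg: "\<And>c. \<exists>p. irreducible p \<and> rpoly p (x + of_rat c * y) = 0"
  obtains c where "x \<in> adjoin (x + of_rat c * y)" "y \<in> adjoin (x + of_rat c * y)"
proof -
  let ?F = "map_poly of_rat f :: complex poly" and ?H = "map_poly of_rat h :: complex poly"
  have nz: "?F \<noteq> 0" "?H \<noteq> 0" using f(1) h(1) by (auto simp: irreducible_def)
  \<comment> \<open>These are the \<open>c\<close> for which other conjugates satisfy
    \<open>x' + c * y' = x + c * y\<close>. Pairs with \<open>y' = y\<close> contribute only the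
    value 0, by division by zero.\<close>
  define bad where "bad = (\<lambda>(x', y'). (x' - x) / (y - y')) ` ({x'. rpoly f x' = 0} \<times> {y'. rpoly h y' = 0})"
  have "finite bad" unfolding bad_def
    using poly_roots_finite[OF nz(1)] poly_roots_finite[OF nz(2)] by simp
  moreover have "infinite (range (of_rat :: rat \<Rightarrow> complex))"
    by (metis finite_imageD infinite_UNIV_char_0 inj_onI of_rat_eq_iff)
  ultimately obtain c :: rat where c: "of_rat c \<notin> bad"
    by (metis finite_subset image_subsetI)
  define \<gamma> where "\<gamma> = x + of_rat c * y"
  obtain p where "irreducible p" "rpoly p \<gamma> = 0" using alg unfolding \<gamma>_def by blast
  then have S: "is_subfield (adjoin \<gamma>)" by (rule adjoin_subfield)
  let ?P = "\<lambda>q. q \<noteq> 0 \<and> poly_over (adjoin \<gamma>) q \<and> poly q y = 0"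
  have "?P ?H" using nz(2) poly_over_rat[OF S] h(2) by blast
  then obtain m where m: "?P m" and min: "\<And>r. ?P r \<Longrightarrow> degree m \<le> degree r"
    using ex_has_least_nat[of ?P ?H degree] by blast
  have dvd: "m dvd q" if "poly_over (adjoin \<gamma>) q" "poly q y = 0" for q
    using minimal_poly_over_dvd[OF S, of m y q] m min that by blast
  have "m dvd ?H" using dvd poly_over_rat[OF S] h(2) by blast
  have lin: "poly_over (adjoin \<gamma>) [:\<gamma>, - of_rat c:]"
    using in_adjoin subfieldD(1,6)[OF S] subfield_of_rat[OF S] by (auto simp: poly_over_pCons_iff poly_over_0[OF S])
  have "m dvd ?F \<circ>\<^sub>p [:\<gamma>, - of_rat c:]"
  proof (rule dvd)
    show "poly_over (adjoin \<gamma>) (?F \<circ>\<^sub>p [:\<gamma>, - of_rat c:])"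
      by (rule poly_over_pcompose[OF S poly_over_rat[OF S] lin])
    show "poly (?F \<circ>\<^sub>p [:\<gamma>, - of_rat c:]) y = 0" using f(2) by (simp add: poly_pcompose \<gamma>_def mult.commute)
  qed
  have root: "y' = y" if "poly m y' = 0" for y'
  proof (rule ccontr)
    assume ne: "y' \<noteq> y"
    have "rpoly h y' = 0" using \<open>m dvd ?H\<close> that by (auto elim!: dvdE)
    moreover have "poly (?F \<circ>\<^sub>p [:\<gamma>, - of_rat c:]) y' = 0"
      using \<open>m dvd ?F \<circ>\<^sub>p _\<close> that by (metis dvdE mult_zero_left poly_mult)
    then have "rpoly f (\<gamma> - of_rat c * y') = 0" by (simp add: poly_pcompose mult.commute)
    ultimately have "((\<gamma> - of_rat c * y') - x) / (y - y') \<in> bad" unfolding bad_def by force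
    moreover have "((\<gamma> - of_rat c * y') - x) / (y - y') = of_rat c"
      using ne by (simp add: \<gamma>_def field_simps)
    ultimately show False using c by simp
  qed
  obtain w where w: "m = [:- y, 1:] * w" using m by (auto simp: poly_eq_0_iff_dvd elim: dvdE)
  \<comment> \<open>A root of the cofactor \<open>w\<close> would again be \<open>y\<close>, making
    it a double root of \<open>?H\<close>.\<close>
  have "degree w = 0"
  proof (rule ccontr)
    assume "degree w \<noteq> 0"
    then obtain a where a: "poly w a = 0"
      using fundamental_theorem_of_algebra constant_degree by metis
    then have "a = y" using root w by simp
    with a have "[:- y, 1:] dvd w" by (simp add: poly_eq_0_iff_dvd)
    then have "[:- y, 1:] ^ 2 dvd m" unfolding w power2_eq_square by (rule mult_dvd_mono[OF dvd_refl])
    then have "[:- y, 1:] ^ 2 dvd ?H" using \<open>m dvd ?H\<close> by (rule dvd_trans)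
    then have "2 \<le> order y ?H" using nz(2) unfolding order_divides by blast
    moreover have "order y ?H \<le> 1" using irreducible_rsquarefree[OF h(1)]
      unfolding rsquarefree_def by (metis le_numeral_extra(4) zero_le)
    ultimately show False by simp
  qed
  then obtain a where a: "w = [:a:]" by (rule degree_eq_zeroE)
  have "m = [:- (y * a), a:]" by (simp add: w a)
  then have "- (y * a) \<in> adjoin \<gamma>" "a \<in> adjoin \<gamma>" "a \<noteq> 0"
    using m by (auto simp: poly_over_pCons_iff)
  then have "- ((- (y * a)) / a) \<in> adjoin \<gamma>" using subfieldD(6,8)[OF S] by blast
  then have y: "y \<in> adjoin \<gamma>" using \<open>a \<noteq> 0\<close> by simp
  have "\<gamma> - of_rat c * y \<in> adjoin \<gamma>"
    using subfieldD(4,5)[OF S] subfield_of_rat[OF S] in_adjoin y by blast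
  then have "x \<in> adjoin \<gamma>" by (simp add: \<gamma>_def)
  with y that show ?thesis unfolding \<gamma>_def by blast
qed

text \<open>By induction on \<open>B\<close>, the generator found so far and the next element are
  merged into one by \<open>primitive_element_pair\<close>.\<close>

lemma primitive_element:
  assumes K: "is_subfield K" and alg: "\<And>x. x \<in> K \<Longrightarrow> \<exists>p. irreducible p \<and> rpoly p x = 0"
    and "finite B" "B \<subseteq> K"
  shows "\<exists>\<theta>\<in>K. B \<subseteq> adjoin \<theta>"
  using assms(3,4)
proof (induction B)
  case empty
  then show ?case using subfieldD(1)[OF K] by blast
next
  case (insert b B)
  then obtain \<theta> where \<theta>: "\<theta> \<in> K" "B \<subseteq> adjoin \<theta>" by auto
  have b: "b \<in> K" using insert.prems by simp
  obtain f where f: "irreducible f" "rpoly f \<theta> = 0" using alg[OF \<theta>(1)] by blast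
  obtain h where h: "irreducible h" "rpoly h b = 0" using alg[OF b] by blast
  have inK: "\<theta> + of_rat c * b \<in> K" for c
    using subfieldD(3,5)[OF K] subfield_of_rat[OF K] \<theta>(1) b by blast
  obtain c where c: "\<theta> \<in> adjoin (\<theta> + of_rat c * b)" "b \<in> adjoin (\<theta> + of_rat c * b)"
    using primitive_element_pair[OF f h] alg[OF inK] by blast
  obtain p where "irreducible p" "rpoly p (\<theta> + of_rat c * b) = 0" using alg[OF inK] by blast
  then have "is_subfield (adjoin (\<theta> + of_rat c * b))" by (rule adjoin_subfield)
  then have "adjoin \<theta> \<subseteq> adjoin (\<theta> + of_rat c * b)" using c(1) by (rule adjoin_subset)
  with c(2) \<theta>(2) inK show ?case by blast
qed

lemma finite_abelian_ext_primitive: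
  assumes "finite_abelian_ext K"
  obtains \<theta> p where "K = adjoin \<theta>" "irreducible p" "rpoly p \<theta> = 0"
proof -
  from assms obtain B where K: "is_subfield K"
    and B: "finite B" "B \<subseteq> K" "K = {\<Sum>b\<in>B. of_rat (c b) * b | c. True}"
    unfolding finite_abelian_ext_def by blast
  have alg: "\<exists>p. irreducible p \<and> rpoly p x = 0" if "x \<in> K" for x
    using finite_span_algebraic[OF K B that] by blast
  obtain \<theta> where \<theta>: "\<theta> \<in> K" "B \<subseteq> adjoin \<theta>" using primitive_element[OF K alg B(1,2)] by blast
  obtain p where p: "irreducible p" "rpoly p \<theta> = 0" using alg[OF \<theta>(1)] by blast
  have S: "is_subfield (adjoin \<theta>)" using p by (rule adjoin_subfield)
  have "K \<subseteq> adjoin \<theta>"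
  proof
    fix x assume "x \<in> K"
    then obtain c where "x = (\<Sum>b\<in>B. of_rat (c b) * b)" using B(3) by blast
    also have "\<dots> \<in> adjoin \<theta>"
      by (rule subfield_sum[OF S]) (use \<theta>(2) subfieldD(5)[OF S] subfield_of_rat[OF S] in blast)
    finally show "x \<in> adjoin \<theta>" .
  qed
  with adjoin_subset[OF K \<theta>(1)] p that show ?thesis by blast
qed

lemma finite_abelian_ext_normal:
  assumes "finite_abelian_ext K" "irreducible p" "x \<in> K" "rpoly p x = 0" "rpoly p y = 0"
  shows "y \<in> K"
  using assms unfolding finite_abelian_ext_def by blast

lemma finite_abelian_ext_algebraic:
  assumes "finite_abelian_ext K" "x \<in> K"
  obtains p where "irreducible p" "rpoly p x = 0"
proof -
  from assms(1) obtain B where "is_subfield K" "finite B" "B \<subseteq> K"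
    "K = {\<Sum>b\<in>B. of_rat (c b) * b | c. True}"
    unfolding finite_abelian_ext_def by blast
  then show ?thesis using finite_span_algebraic[OF _ _ _ _ assms(2)] that by blast
qed

subsection \<open>Conjugates in an abelian field\<close>

text \<open>The map is well defined and injective because a rational polynomial vanishes at
  \<open>\<theta>\<close>, or at \<open>\<theta>'\<close>, exactly when \<open>p\<close> divides it.
  Normality puts \<open>\<theta>'\<close> into \<open>K\<close>.\<close>

lemma conjugate_field_aut:
  assumes K: "finite_abelian_ext K" "K = adjoin \<theta>" and p: "irreducible p" "rpoly p \<theta> = 0"
    and \<theta>': "rpoly p \<theta>' = 0"
  obtains \<sigma> where "field_aut K \<sigma>" "\<And>a. \<sigma> (rpoly a \<theta>) = rpoly a \<theta>'"
proof -
  have sub: "is_subfield K" using K(1) by (simp add: finite_abelian_ext_def)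
  have \<theta>'K: "\<theta>' \<in> K" using finite_abelian_ext_normal[OF K(1) p(1) _ p(2) \<theta>'] K(2) in_adjoin by simp
  have eq_iff: "rpoly a \<theta> = rpoly b \<theta> \<longleftrightarrow> rpoly a \<theta>' = rpoly b \<theta>'" for a b
  proof -
    have "rpoly (a - b) \<theta> = 0 \<longleftrightarrow> p dvd a - b"
      using irreducible_dvd_of_root[OF p] rpoly_dvd p(2) by blast
    moreover have "rpoly (a - b) \<theta>' = 0 \<longleftrightarrow> p dvd a - b"
      using irreducible_dvd_of_root[OF p(1) \<theta>'] rpoly_dvd \<theta>' by blast
    ultimately show ?thesis by simp
  qed
  \<comment> \<open>Any representing polynomial may be chosen: by \<open>eq_iff\<close> the value at
    \<open>\<theta>'\<close> does not depend on it.\<close>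
  define \<sigma> where "\<sigma> x = rpoly (SOME a. rpoly a \<theta> = x) \<theta>'" for x
  have \<sigma>: "\<sigma> (rpoly a \<theta>) = rpoly a \<theta>'" for a
  proof -
    have "rpoly (SOME b. rpoly b \<theta> = rpoly a \<theta>) \<theta> = rpoly a \<theta>" by (rule someI) (rule refl)
    then show ?thesis unfolding \<sigma>_def using eq_iff by blast
  qed
  have rep: "\<exists>a. x = rpoly a \<theta>" if "x \<in> K" for x using that K(2) by (auto simp: adjoin_def)
  have inj: "inj_on \<sigma> K"
    by (rule inj_onI) (metis rep \<sigma> eq_iff)
  \<comment> \<open>\<open>\<sigma>\<close> maps the finite root set of the irreducible polynomial
    of \<open>x\<close> injectively into itself, hence onto itself.\<close>
  have surj: "x \<in> \<sigma> ` K" if x: "x \<in> K" for x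
  proof -
    obtain q where q: "irreducible q" "rpoly q x = 0" using finite_abelian_ext_algebraic[OF K(1) x] .
    define R where "R = {r. rpoly q r = 0}"
    have "map_poly of_rat q \<noteq> (0 :: complex poly)" using q(1) by (auto simp: irreducible_def)
    then have fin: "finite R" unfolding R_def by (rule poly_roots_finite)
    have RK: "R \<subseteq> K" using finite_abelian_ext_normal[OF K(1) q(1) x q(2)] by (auto simp: R_def)
    have "\<sigma> ` R \<subseteq> R"
    proof
      fix s assume "s \<in> \<sigma> ` R"
      then obtain r where r: "s = \<sigma> r" "r \<in> R" by blast
      then obtain a where a: "r = rpoly a \<theta>" using rep RK by blast
      have "rpoly (q \<circ>\<^sub>p a) \<theta> = rpoly 0 \<theta>" using r(2) a by (simp add: rpoly_pcompose R_def)
      then have "rpoly (q \<circ>\<^sub>p a) \<theta>' = rpoly 0 \<theta>'" using eq_iff by blast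
      then show "s \<in> R" using r(1) a \<sigma> by (simp add: rpoly_pcompose R_def)
    qed
    then have "\<sigma> ` R = R" using endo_inj_surj[OF fin] inj_on_subset[OF inj RK] by blast
    then show ?thesis using RK q(2) unfolding R_def by blast
  qed
  have "\<sigma> ` K \<subseteq> K"
  proof
    fix s assume "s \<in> \<sigma> ` K"
    then obtain a where "s = rpoly a \<theta>'" using rep \<sigma> by auto
    then show "s \<in> K" using subfield_rpoly[OF sub \<theta>'K] by simp
  qed
  with surj inj have bij: "bij_betw \<sigma> K K" unfolding bij_betw_def by blast
  have "\<sigma> 1 = 1" using \<sigma>[of 1] by simp
  moreover have "\<sigma> (x + y) = \<sigma> x + \<sigma> y \<and> \<sigma> (x * y) = \<sigma> x * \<sigma> y" if "x \<in> K" "y \<in> K" for x y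
  proof -
    obtain a b where ab: "x = rpoly a \<theta>" "y = rpoly b \<theta>" using rep \<open>x \<in> K\<close> \<open>y \<in> K\<close> by blast
    show ?thesis using \<sigma>[of "a + b"] \<sigma>[of "a * b"] \<sigma>[of a] \<sigma>[of b] by (simp add: ab)
  qed
  ultimately have "field_aut K \<sigma>" using bij unfolding field_aut_def by blast
  with \<sigma> that show ?thesis by blast
qed

section \<open>Norms and conjugates of large absolute value\<close>

lemma poly_eq_prod_proots:
  fixes P :: "complex poly"
  shows "poly P y = lead_coeff P * (\<Prod>x\<in>#proots P. y - x)"
proof -
  have "poly P y = poly (smult (lead_coeff P) (\<Prod>x\<in>#proots P. [:- x, 1:])) y"
    by (simp only: complex_poly_decompose_multiset)
  then show ?thesis by (simp add: poly_prod_mset image_mset.compositionality o_def algebra_simps)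
qed

lemma prod_mset_Rats: "(\<And>x. x \<in># A \<Longrightarrow> f x \<in> \<rat>) \<Longrightarrow> (\<Prod>x\<in>#A. f x :: complex) \<in> \<rat>"
  by (induction A) auto

text \<open>The Euclidean algorithm for the resultant: reduce \<open>a\<close> modulo \<open>p\<close>, then exchange the two polynomials.\<close>

lemma prod_over_roots_rational:
  fixes p a :: "rat poly"
  assumes "p \<noteq> 0"
  shows "(\<Prod>x\<in>#proots (map_poly of_rat p :: complex poly). rpoly a x) \<in> \<rat>"
  using assms
proof (induction "degree p" arbitrary: p a rule: less_induct)
  case less
  let ?P = "map_poly of_rat p :: complex poly"
  have P0: "?P \<noteq> 0" using less.prems by simp
  define r where "r = a mod p"
  let ?R = "map_poly of_rat r :: complex poly"
  have mod: "rpoly a x = rpoly r x" if "x \<in># proots ?P" for x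
  proof -
    have "rpoly p x = 0" using that P0 by simp
    moreover have "rpoly a x = rpoly (a div p * p + r) x" by (simp only: r_def div_mult_mod_eq)
    ultimately show ?thesis by simp
  qed
  then have eq: "(\<Prod>x\<in>#proots ?P. rpoly a x) = (\<Prod>x\<in>#proots ?P. rpoly r x)"
    by (intro arg_cong[of _ _ prod_mset] image_mset_cong) simp
  show ?case
  proof (cases "degree p = 0 \<or> r = 0")
    case True
    then show ?thesis
    proof
      assume "degree p = 0"
      then have "proots ?P = {#}" using size_proots_complex[of ?P] by simp
      then show ?thesis by simp
    next
      assume "r = 0"
      then show ?thesis unfolding eq by (intro prod_mset_Rats) simp
    qed
  next
    case False
    then have dr: "degree r < degree p" unfolding r_def by (intro degree_mod_less') auto
    have R0: "?R \<noteq> 0" using False by simp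
    \<comment> \<open>\<open>\<kappa>\<close> collects the signs from turning \<open>y - x\<close>
      into \<open>x - y\<close>, and divides out the leading coefficient of
      \<open>?P\<close>.\<close>
    define \<kappa> where "\<kappa> = (-1) ^ size (proots ?P) / lead_coeff ?P"
    have \<kappa>: "\<kappa> \<in> \<rat>" unfolding \<kappa>_def by (simp add: Rats_divide)
    have swap: "(\<Prod>x\<in>#proots ?P. x - y) = \<kappa> * rpoly p y" for y
    proof -
      have "(\<Prod>x\<in>#proots ?P. x - y) = (\<Prod>x\<in>#proots ?P. (-1) * (y - x))" by simp
      also have "\<dots> = (-1) ^ size (proots ?P) * (\<Prod>x\<in>#proots ?P. y - x)"
        by (simp only: prod_mset.distrib prod_mset_constant)
      also have "\<dots> = \<kappa> * rpoly p y"
        using P0 by (subst poly_eq_prod_proots) (simp add: \<kappa>_def)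
      finally show ?thesis .
    qed
    have "(\<Prod>x\<in>#proots ?P. rpoly r x)
        = (\<Prod>x\<in>#proots ?P. lead_coeff ?R * (\<Prod>y\<in>#proots ?R. x - y))"
      by (subst poly_eq_prod_proots) (rule refl)
    also have "\<dots> = lead_coeff ?R ^ size (proots ?P) * (\<Prod>x\<in>#proots ?P. \<Prod>y\<in>#proots ?R. x - y)"
      by (simp only: prod_mset.distrib prod_mset_constant)
    also have "(\<Prod>x\<in>#proots ?P. \<Prod>y\<in>#proots ?R. x - y) = (\<Prod>y\<in>#proots ?R. \<Prod>x\<in>#proots ?P. x - y)"
      by (rule prod_mset.swap)
    also have "\<dots> = \<kappa> ^ size (proots ?R) * (\<Prod>y\<in>#proots ?R. rpoly p y)"
      by (simp only: swap prod_mset.distrib prod_mset_constant)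
    also have "lead_coeff ?R ^ size (proots ?P) * \<dots> \<in> \<rat>"
      using less.hyps[OF dr, of p] False \<kappa> by (intro Rats_mult Rats_power) auto
    finally show ?thesis unfolding eq .
  qed
qed

lemma prod_mset_algebraic_int:
  "(\<And>x. x \<in># A \<Longrightarrow> algebraic_int (f x)) \<Longrightarrow> algebraic_int (\<Prod>x\<in>#A. f x :: complex)"
  by (induction A) (auto intro!: algebraic_int_times)

lemma prod_mset_norm_less_1:
  fixes f :: "'a \<Rightarrow> complex"
  assumes "\<And>x. x \<in># A \<Longrightarrow> norm (f x) < 1" "A \<noteq> {#}"
  shows "norm (\<Prod>x\<in>#A. f x) < 1"
  using assms
proof (induction A)
  case (add x A)
  show ?case
  proof (cases "A = {#}")
    case False
    then have "norm (\<Prod>x\<in>#A. f x) < 1" using add by simp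
    then have "norm (f x) * norm (\<Prod>x\<in>#A. f x) < 1 * 1"
      using add.prems by (intro mult_strict_mono') auto
    then show ?thesis by (simp add: norm_mult)
  qed (use add in simp)
qed simp

text \<open>The norm \<open>N\<close> of \<open>a\<close> is a nonzero rational algebraic integer,
  hence an integer of absolute value at least 1. So some factor has absolute value at least 1, and
  it is the image of \<open>a\<close> under the automorphism taking \<open>\<theta>\<close> to the
  root in question.\<close>

lemma algebraic_int_large_conjugate:
  assumes K: "finite_abelian_ext K" and a: "a \<in> K" "a \<noteq> 0" "algebraic_int a"
  obtains \<sigma> where "field_aut K \<sigma>" "norm (\<sigma> a) \<ge> 1"
proof -
  obtain \<theta> p where \<theta>: "K = adjoin \<theta>" "irreducible p" "rpoly p \<theta> = 0"
    using finite_abelian_ext_primitive[OF K] .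
  obtain A where A: "a = rpoly A \<theta>" using a(1) \<theta>(1) by (auto simp: adjoin_def)
  let ?P = "map_poly of_rat p :: complex poly"
  define N where "N = (\<Prod>x\<in>#proots ?P. rpoly A x)"
  have p0: "p \<noteq> 0" "?P \<noteq> 0" using \<theta>(2) by auto
  have root: "x \<in># proots ?P \<longleftrightarrow> rpoly p x = 0" for x using p0 by simp
  obtain q where q: "poly (map_poly of_int q) a = 0" "lead_coeff q = 1"
    using a(3) unfolding algebraic_int_altdef_ipoly by blast
  \<comment> \<open>Over the rationals, the composition of \<open>q'\<close> with \<open>A\<close>
    is divisible by \<open>p\<close>, which carries integrality from \<open>a\<close> to all its
    conjugates.\<close>
  define q' where "q' = (map_poly of_int q :: rat poly)"
  have q': "map_poly of_rat q' = (map_poly of_int q :: complex poly)"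
    unfolding q'_def by (rule poly_eqI) (simp add: coeff_map_poly)
  have "algebraic_int (rpoly A x)" if "rpoly p x = 0" for x
  proof -
    have "rpoly (q' \<circ>\<^sub>p A) \<theta> = 0" using q A by (simp add: rpoly_pcompose q')
    then have "p dvd q' \<circ>\<^sub>p A" using irreducible_dvd_of_root \<theta>(2,3) by blast
    then have "rpoly (q' \<circ>\<^sub>p A) x = 0" using that by (rule rpoly_dvd)
    then have "poly (map_poly of_int q) (rpoly A x) = 0" by (simp add: rpoly_pcompose q')
    then show ?thesis using q(2) unfolding algebraic_int_altdef_ipoly by blast
  qed
  then have "algebraic_int N" unfolding N_def by (intro prod_mset_algebraic_int) (simp only: root)
  moreover have "N \<in> \<rat>" unfolding N_def using prod_over_roots_rational p0(1) .
  ultimately have "N \<in> \<int>" by (rule rational_algebraic_int_is_int)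
  have "rpoly A x \<noteq> 0" if "rpoly p x = 0" for x
  proof
    assume "rpoly A x = 0"
    then have "p dvd A" using irreducible_dvd_of_root \<theta>(2) that by blast
    then show False using a(2) A \<theta>(3) rpoly_dvd by blast
  qed
  then have "N \<noteq> 0" unfolding N_def by (auto simp: root simp del: set_count_proots)
  with \<open>N \<in> \<int>\<close> have "norm N \<ge> 1" by (auto elim!: Ints_cases)
  moreover have "proots ?P \<noteq> {#}" using root[of \<theta>] \<theta>(3) by auto
  ultimately obtain x where x: "x \<in># proots ?P" "norm (rpoly A x) \<ge> 1"
    using prod_mset_norm_less_1[of "proots ?P" "rpoly A"] unfolding N_def by force
  obtain \<sigma> where "field_aut K \<sigma>" "\<And>b. \<sigma> (rpoly b \<theta>) = rpoly b x"
    using conjugate_field_aut[OF K \<theta>] x(1) root by metis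
  with x(2) A that show ?thesis by simp
qed

section \<open>Complex conjugation on an abelian field\<close>

lemma cnj_rpoly: "cnj (rpoly p x) = rpoly p (cnj x)"
proof (induction p)
  case (pCons c p)
  have "cnj (of_rat c) = (of_rat c :: complex)"
    by (cases c rule: Rat_cases) (simp add: Fract_of_int_quotient of_rat_divide)
  then show ?case using pCons.IH by (simp add: rpoly_pCons)
qed simp

lemma cnj_in_finite_abelian_ext:
  assumes K: "finite_abelian_ext K" and x: "x \<in> K"
  shows "cnj x \<in> K"
proof -
  obtain p where p: "irreducible p" "rpoly p x = 0" using finite_abelian_ext_algebraic[OF K x] .
  have "rpoly p (cnj x) = 0" using p(2) by (simp flip: cnj_rpoly)
  then show ?thesis using finite_abelian_ext_normal[OF K p(1) x p(2)] by blast
qed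

text \<open>By normality, conjugation restricts to an automorphism of \<open>K\<close>, so the
  commutativity in \<open>finite_abelian_ext\<close> applies to it. This is where the abelian
  hypothesis enters.\<close>

lemma field_aut_commutes_cnj:
  assumes K: "finite_abelian_ext K" and \<sigma>: "field_aut K \<sigma>" and x: "x \<in> K"
  shows "\<sigma> (cnj x) = cnj (\<sigma> x)"
proof -
  have "bij_betw cnj K K"
    by (rule bij_betwI[of _ _ _ cnj]) (auto intro: cnj_in_finite_abelian_ext[OF K])
  then have "field_aut K cnj" unfolding field_aut_def by auto
  with assms show ?thesis unfolding finite_abelian_ext_def by blast
qed

subsection \<open>Period three multipliers\<close>

text \<open>Setting \<open>C = z\<close> commutes with the resultant; its vanishing forces a
  nonconstant gcd of the two specialized polynomials, hence a common complex root.\<close>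

lemma Delta_tilde_rootD:
  assumes k: "k \<ge> 1" and z: "poly (Delta_tilde k) z = 0"
  obtains j where "1 \<le> j" "j \<le> k" "coprime j k"
    "poly [:64 + 16*z + 8*z^2 + z^3, -16 - 2*z, 1:] (cis (2 * pi * real j / real k)) = 0"
proof -
  let ?J = "{j. 1 \<le> j \<and> j \<le> k \<and> coprime j k}"
  have fin: "finite ?J" by (rule finite_subset[of _ "{..k}"]) auto
  have monic: "lead_coeff (cyclo_poly k) = 1"
    unfolding cyclo_poly_def by (simp add: lead_coeff_prod)
  have hom: "comm_ring_hom (\<lambda>p::complex poly. poly p z)"
    by unfold_locales auto
  let ?p = "map_poly (\<lambda>a. [:a:]) (cyclo_poly k)"
  let ?q = "[:64 + 16*z + 8*z^2 + z^3, -16 - 2*z, 1:]"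
  have dp: "degree ?p = degree (cyclo_poly k)"
    by (rule degree_map_poly) auto
  have pe: "map_poly (\<lambda>p. poly p z) ?p = cyclo_poly k"
    by (rule poly_eqI) (simp add: coeff_map_poly)
  have qe: "map_poly (\<lambda>p. poly p z) delta3 = ?q"
    by (simp add: delta3_def map_poly_pCons power2_eq_square power3_eq_cube algebra_simps)
  \<comment> \<open>Both degrees survive the evaluation: the first polynomial has constants as
    coefficients, and \<open>delta3\<close> is monic in \<open>x\<close>.\<close>
  have "resultant (map_poly (\<lambda>p. poly p z) ?p) (map_poly (\<lambda>p. poly p z) delta3)
      = poly (resultant ?p delta3) z"
    by (rule comm_ring_hom.resultant_map_poly[OF hom]) (simp only: pe dp, simp only: qe, simp add: delta3_def)
  then have "resultant (cyclo_poly k) ?q = poly (Delta_tilde k) z"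
    unfolding Delta_tilde_def pe qe .
  then have "degree (gcd (cyclo_poly k) ?q) \<noteq> 0"
    using z resultant_0_gcd by metis
  then obtain x where x: "poly (gcd (cyclo_poly k) ?q) x = 0"
    using fundamental_theorem_of_algebra constant_degree by metis
  have x1: "poly (cyclo_poly k) x = 0" and x2: "poly ?q x = 0"
    using x by (meson dvd_trans gcd_dvd1 gcd_dvd2 poly_eq_0_iff_dvd)+
  from x1 obtain j where "j \<in> ?J" "x = cis (2 * pi * real j / real k)"
    unfolding cyclo_poly_def using fin by (auto simp: poly_prod)
  with x2 that show ?thesis by auto
qed

lemma cis_coprime_root:
  assumes "k \<ge> 2" "coprime j k"
  shows "cis (2 * pi * real j / real k) ^ k = 1" "cis (2 * pi * real j / real k) \<noteq> 1"
proof -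
  show "cis (2 * pi * real j / real k) ^ k = 1"
    using assms by (simp add: DeMoivre)
  show "cis (2 * pi * real j / real k) \<noteq> 1"
  proof
    assume "cis (2 * pi * real j / real k) = 1"
    then have "cos (2 * pi * real j / real k) = 1"
      by (metis cis.sel(1) one_complex.sel(1))
    then obtain i :: int where i: "2 * pi * real j / real k = of_int i * 2 * pi"
      using cos_one_2pi_int by blast
    then have "real j = of_int i * real k"
      using assms by (simp add: field_simps)
    then have "int j = i * int k"
      by (metis of_int_eq_iff of_int_mult of_int_of_nat_eq)
    then have "k dvd j"
      by (metis dvd_triv_right int_dvd_int_iff)
    with assms show False
      by (metis One_nat_def Suc_1 coprime_absorb_right is_unit_gcd nat_dvd_1_iff_1 not_less_eq_eq order_refl)
  qed
qed

section \<open>The rational curve and its points with unimodular multiplier\<close>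

definition per3_mult :: "complex \<Rightarrow> complex" where
  "per3_mult t = t ^ 3 - t ^ 2 + 7 * t + 1"

text \<open>Completing the square gives \<open>(x - 8 - z) ^ 2 = z ^ 2 * (- 7 - z)\<close>, which
  suggests \<open>t = (8 - x + z) / z\<close>. The norm condition excludes \<open>z = 0\<close>,
  where \<open>x\<close> would be 8.\<close>

lemma delta3_rational_param:
  fixes x z :: complex
  assumes "poly [:64 + 16*z + 8*z^2 + z^3, -16 - 2*z, 1:] x = 0" "norm x = 1"
  obtains t where "t ^ 2 = - 7 - z" "x = 8 + z - t * z"
proof -
  have z0: "z \<noteq> 0"
  proof
    assume "z = 0"
    then have "(x - 8) ^ 2 = 0" using assms(1) by (simp add: power2_eq_square power3_eq_cube algebra_simps)
    then show False using assms(2) by simp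
  qed
  define t where "t = (8 - x + z) / z"
  have tz: "t * z = 8 - x + z" using z0 by (simp add: t_def)
  have "(t ^ 2 + 7 + z) * z ^ 2 = (t * z) ^ 2 + 7 * z ^ 2 + z ^ 3"
    by (simp add: algebra_simps power2_eq_square power3_eq_cube)
  also have "\<dots> = 0" unfolding tz using assms(1)
    by (simp add: algebra_simps power2_eq_square power3_eq_cube)
  finally have "t ^ 2 + 7 + z = 0" using z0 by simp
  then have "t ^ 2 = - 7 - z" using eq_neg_iff_add_eq_0[of "t ^ 2" "7 + z"] by (simp add: add.assoc)
  moreover have "x = 8 + z - t * z" using tz by simp
  ultimately show ?thesis using that by blast
qed

text \<open>Let \<open>e\<close> be half the sum and \<open>\<eta>\<close> the product of the
  multipliers. Unimodularity gives \<open>\<eta> * cnj e = e\<close>, hence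
  \<open>norm (\<eta> - 1) \<le> 2 * norm (e - 1)\<close>. But \<open>\<eta> - 1\<close> is
  \<open>e - 1\<close> times a factor of norm at least 49, so \<open>e = 1\<close>.\<close>

lemma both_mults_unimodular:
  fixes x y z :: complex
  assumes "norm x = 1" "norm y = 1" and z: "x + y = 16 + 2 * z" "x * y = (8 + z) ^ 2 + (7 + z) * z ^ 2"
  shows "z = -7"
proof -
  define e \<eta> where "e = 8 + z" and "\<eta> = x * y"
  have e: "x + y = 2 * e" using z by (simp add: e_def)
  have eta: "(e - 1) * (e ^ 2 - 15 * e + 65) = \<eta> - 1"
    unfolding \<eta>_def z e_def by (simp add: algebra_simps power2_eq_square)
  have "norm (2 * e) \<le> 2" using norm_triangle_ineq[of x y] assms by (simp flip: e)
  then have ne: "norm e \<le> 1" by (simp add: norm_mult)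
  have xx: "x * cnj x = 1" "y * cnj y = 1" using assms by (simp_all add: complex_norm_square[symmetric])
  \<comment> \<open>On the unit circle \<open>cnj x\<close> and \<open>cnj y\<close> are the
    inverses of \<open>x\<close> and \<open>y\<close>.\<close>
  have "2 * (\<eta> * cnj e) = x * y * (cnj x + cnj y)"
    by (simp add: \<eta>_def flip: e complex_cnj_add) (metis complex_cnj_add complex_cnj_mult complex_cnj_numeral e mult.left_commute)
  also have "\<dots> = 2 * e" unfolding e[symmetric] using xx
    by (metis (no_types, opaque_lifting) distrib_left mult.assoc mult.commute mult.right_neutral add.commute)
  finally have "\<eta> * cnj e = e" by simp
  then have "\<eta> - 1 = (e - 1) - \<eta> * cnj (e - 1)" by (simp add: algebra_simps)
  moreover have "norm (\<eta> * cnj (e - 1)) = norm (e - 1)"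
    unfolding norm_mult complex_mod_cnj \<eta>_def norm_mult assms(1,2) by simp
  ultimately have le: "norm (\<eta> - 1) \<le> 2 * norm (e - 1)"
    using norm_triangle_ineq4[of "e - 1" "\<eta> * cnj (e - 1)"] by (simp only:)
  have "norm (15 * e - e ^ 2) \<le> 16"
  proof -
    have "norm (15 * e - e ^ 2) \<le> 15 * norm e + norm e ^ 2"
      using norm_triangle_ineq4[of "15 * e" "e ^ 2"] by (simp add: norm_mult norm_power)
    moreover have "norm e ^ 2 \<le> 1" using ne by (simp add: power_le_one)
    ultimately show ?thesis using ne by linarith
  qed
  then have "norm (e ^ 2 - 15 * e + 65) \<ge> 49"
    using norm_triangle_ineq2[of "65" "15 * e - e ^ 2"] by (simp add: algebra_simps)
  then have "norm (e - 1) * 49 \<le> norm (\<eta> - 1)"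
    unfolding eta[symmetric] norm_mult by (intro mult_left_mono) auto
  with le have "norm (e - 1) \<le> 0" by linarith
  then have "e = 1" by simp
  moreover have "z = e - 8" by (simp add: e_def)
  ultimately show ?thesis by simp
qed

lemma per3_mult_minus_1: "per3_mult t - 1 = t * (t ^ 2 - t + 7)"
  by (simp add: per3_mult_def algebra_simps power2_eq_square power3_eq_cube)

text \<open>The bound \<open>norm (t * (t ^ 2 - t + 7)) \<le> 2\<close> drives the estimate. Away
  from 0 the point is far from one root of \<open>t ^ 2 - t + 7\<close>, so its distance to the
  other root \<open>r\<close> is small; and \<open>t + cnj t - 1\<close> is twice
  \<open>Re (t - r)\<close>.\<close>

lemma unimodular_mult_small:
  assumes "norm (per3_mult t) = 1"
  shows "norm (t * (t + cnj t - 1)) < 1"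
proof (cases "norm t < 1/2")
  case True
  have "norm (t + cnj t - 1) \<le> norm t + norm t + 1"
    by (metis (no_types) complex_mod_cnj norm_one norm_triangle_ineq4 norm_triangle_le add_mono_thms_linordered_semiring(3) norm_triangle_ineq order_trans)
  then have "norm (t + cnj t - 1) \<le> 2" using True by linarith
  then have "norm t * norm (t + cnj t - 1) \<le> norm t * 2" by (intro mult_left_mono) auto
  then show ?thesis using True by (simp add: norm_mult)
next
  case False
  have bound: "norm s * norm (s ^ 2 - s + 7) \<le> 2" if "norm (per3_mult s) = 1" for s
    using norm_triangle_ineq4[of "per3_mult s" 1] that by (simp add: per3_mult_minus_1 norm_mult)
  text \<open>\<open>r\<close> is the root of \<open>t\<^sup>2 - t + 7\<close> in the upper half plane.\<close>
  define r where "r = Complex (1/2) (sqrt (27/4))"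
  have main: "norm (s * (s + cnj s - 1)) < 1"
    if s: "norm (per3_mult s) = 1" "norm s \<ge> 1/2" "Im s \<ge> 0" for s
  proof -
    have fac: "s ^ 2 - s + 7 = (s - r) * (s - cnj r)"
      by (simp add: r_def complex_eq_iff algebra_simps power2_eq_square)
    have q0: "(Re s - 1/2) ^ 2 \<ge> 0" by simp
    have "norm s * norm (s ^ 2 - s + 7) \<ge> 1/2 * norm (s ^ 2 - s + 7)"
      using s by (intro mult_right_mono) auto
    then have "norm (s ^ 2 - s + 7) \<le> 4" using bound[OF s(1)] by linarith
    then have "Re (s ^ 2 - s + 7) \<le> 4" using complex_Re_le_cmod order_trans by blast
    \<comment> \<open>The real part of \<open>s ^ 2 - s + 7\<close> is
      \<open>(Re s - 1/2) ^ 2 + 27/4 - (Im s) ^ 2\<close>.\<close>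
    then have "(Im s) ^ 2 \<ge> 11/4 + (Re s - 1/2) ^ 2"
      by (simp add: power2_eq_square algebra_simps)
    then have "(Im s) ^ 2 \<ge> 9/4" using q0 by linarith
    then have "(Im s) ^ 2 \<ge> (3/2) ^ 2" by (simp add: power_divide)
    then have im: "Im s \<ge> 3/2" using s(3) by (rule power2_le_imp_le)
    have "sqrt (27/4) > 5/2" by (rule real_less_rsqrt) (simp add: power2_eq_square)
    then have "Im (s - cnj r) > 4" using im by (simp add: r_def)
    then have big: "norm (s - cnj r) > 4" using abs_Im_le_cmod[of "s - cnj r"] by linarith
    have "norm (s + cnj s - 1) = 2 * \<bar>Re (s - r)\<bar>"
    proof -
      have "s + cnj s - 1 = complex_of_real (2 * Re (s - r))"
        by (simp add: r_def complex_eq_iff)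
      then show ?thesis by (simp only: norm_of_real abs_mult)
    qed
    then have "norm (s + cnj s - 1) \<le> 2 * norm (s - r)" using abs_Re_le_cmod[of "s - r"] by linarith
    then have "norm (s * (s + cnj s - 1)) \<le> norm s * (2 * norm (s - r))"
      unfolding norm_mult by (intro mult_left_mono) auto
    moreover have "norm s * norm (s - r) < 1/2"
    proof (rule ccontr)
      assume "\<not> ?thesis"
      then have "norm s * norm (s - r) * norm (s - cnj r) > 2"
        using mult_right_mono[of "1/2" "norm s * norm (s - r)" "norm (s - cnj r)"] big by simp
      then show False using bound[OF s(1)] by (simp add: fac norm_mult mult.assoc)
    qed
    ultimately show ?thesis by linarith
  qed
  show ?thesis
  proof (cases "Im t \<ge> 0")
    case True
    with main[of t] assms False show ?thesis by auto
  next
    case im: False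
    \<comment> \<open>Since \<open>per3_mult\<close> has real coefficients, the lower half plane
      reduces to the upper one.\<close>
    have "per3_mult (cnj t) = cnj (per3_mult t)" by (simp add: per3_mult_def)
    then have "norm (cnj t * (cnj t + cnj (cnj t) - 1)) < 1"
      using main[of "cnj t"] assms False im by auto
    then show ?thesis by (simp only: norm_mult complex_mod_cnj complex_cnj_cnj add.commute)
  qed
qed

text \<open>On the line \<open>Re t = 1/2\<close>, both \<open>t ^ 2 - t + 7\<close> and
  \<open>7 - t * cnj t\<close> equal one real number \<open>m\<close>. The condition
  \<open>norm (1 + t * m) = 1\<close> with \<open>m \<noteq> 0\<close> becomes
  \<open>m * m = 1 + 7 * m\<close>, and \<open>m \<le> 27/4\<close> selects the root between -1 and
  0.\<close>

lemma unimodular_mult_Re_half: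
  assumes "norm (per3_mult t) = 1" "per3_mult t \<noteq> 1" "t + cnj t = 1"
  shows "norm (7 - t * cnj t) < 1" "7 - t * cnj t \<noteq> 0"
proof -
  define y where "y = Im t"
  have re: "Re t = 1/2" using assms(3) by (simp add: complex_eq_iff)
  define m where "m = 27/4 - y ^ 2"
  have q: "t * cnj t = complex_of_real (7 - m)"
    by (simp add: complex_eq_iff re m_def y_def power2_eq_square algebra_simps)
  have "t ^ 2 - t + 7 = complex_of_real m"
    by (simp add: complex_eq_iff re m_def y_def power2_eq_square algebra_simps)
  then have g: "per3_mult t = 1 + t * m" using per3_mult_minus_1[of t] by (simp add: algebra_simps)
  then have m0: "m \<noteq> 0" using assms(2) by auto
  have "1 = per3_mult t * cnj (per3_mult t)"
    using assms(1) by (simp add: complex_norm_square[symmetric])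
  also have "\<dots> = 1 + (t + cnj t) * m + (t * cnj t) * m ^ 2"
    by (simp add: g algebra_simps power2_eq_square)
  also have "\<dots> = complex_of_real (1 + m + (7 - m) * m ^ 2)"
    unfolding q assms(3) by simp
  finally have "1 = 1 + m + (7 - m) * m ^ 2"
    by (metis of_real_1 of_real_eq_iff)
  then have "m * (1 + (7 - m) * m) = 0" by (simp add: algebra_simps power2_eq_square)
  then have eq: "m * m = 1 + 7 * m" using m0 by (simp add: left_diff_distrib)
  have m7: "m \<le> 27/4" by (simp add: m_def)
  have "m < 0"
  proof (rule ccontr)
    assume "\<not> m < 0"
    then have "m * m \<le> m * 7" using m7 by (intro mult_left_mono) auto
    then show False using eq by linarith
  qed
  moreover have "m > -1"
  proof (rule ccontr)
    assume "\<not> m > -1"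
    then have "m * m \<ge> 0" "1 + 7 * m < 0" by auto
    then show False using eq by linarith
  qed
  ultimately have "\<bar>m\<bar> < 1" by linarith
  moreover have "7 - t * cnj t = complex_of_real m" by (simp add: q)
  ultimately show "norm (7 - t * cnj t) < 1" "7 - t * cnj t \<noteq> 0"
    using m0 by (simp_all only: norm_of_real of_real_eq_0_iff not_False_eq_True)
qed

lemma algebraic_int_per3_mult_preimage:
  assumes "algebraic_int (per3_mult t)"
  shows "algebraic_int t"
proof (rule algebraic_int_root[OF assms, of "[:1, 7, -1, 1:]"])
  show "poly [:1, 7, - 1, 1:] t = per3_mult t"
    by (simp add: per3_mult_def algebra_simps power2_eq_square power3_eq_cube)
  show "\<forall>i. coeff [:1, 7, - 1, 1:: complex:] i \<in> \<int>"
    by (simp add: coeff_pCons split: nat.split)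
qed auto

section \<open>Automorphisms, the field of the parameter, and the contradiction\<close>

lemma field_autD:
  assumes "field_aut K \<sigma>" "is_subfield K"
  shows "x \<in> K \<Longrightarrow> \<sigma> x \<in> K" "\<sigma> 1 = 1" "\<sigma> 0 = 0"
    "x \<in> K \<Longrightarrow> y \<in> K \<Longrightarrow> \<sigma> (x + y) = \<sigma> x + \<sigma> y" "x \<in> K \<Longrightarrow> y \<in> K \<Longrightarrow> \<sigma> (x * y) = \<sigma> x * \<sigma> y"
    "x \<in> K \<Longrightarrow> y \<in> K \<Longrightarrow> \<sigma> (x - y) = \<sigma> x - \<sigma> y" "x \<in> K \<Longrightarrow> \<sigma> (x ^ n) = \<sigma> x ^ n"
    "\<sigma> (of_nat n) = of_nat n" "x \<in> K \<Longrightarrow> y \<in> K \<Longrightarrow> \<sigma> x = \<sigma> y \<Longrightarrow> x = y"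
proof -
  note K = subfieldD[OF assms(2)]
  show "x \<in> K \<Longrightarrow> \<sigma> x \<in> K" and one: "\<sigma> 1 = 1"
    using assms(1) unfolding field_aut_def bij_betw_def by auto
  show "x \<in> K \<Longrightarrow> y \<in> K \<Longrightarrow> \<sigma> x = \<sigma> y \<Longrightarrow> x = y"
    using assms(1) unfolding field_aut_def bij_betw_def by (metis inj_onD)
  show add: "x \<in> K \<Longrightarrow> y \<in> K \<Longrightarrow> \<sigma> (x + y) = \<sigma> x + \<sigma> y"
    and mult: "x \<in> K \<Longrightarrow> y \<in> K \<Longrightarrow> \<sigma> (x * y) = \<sigma> x * \<sigma> y" for x y
    using assms(1) unfolding field_aut_def by auto
  show zero: "\<sigma> 0 = 0" using add[of 0 0] K(1) by simp
  show "x \<in> K \<Longrightarrow> y \<in> K \<Longrightarrow> \<sigma> (x - y) = \<sigma> x - \<sigma> y"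
    using add[of "x - y" y] K(4)[of x y] by simp
  show "\<sigma> (x ^ n) = \<sigma> x ^ n" if "x \<in> K"
    using that by (induction n) (auto simp: one mult subfield_power[OF assms(2)])
  have "of_nat n \<in> K" for n using subfield_of_rat[OF assms(2), of "of_nat n"] by simp
  then show "\<sigma> (of_nat n) = of_nat n"
    by (induction n) (auto simp: zero one add K(2))
qed

lemma field_aut_per3_mult:
  assumes \<sigma>: "field_aut K \<sigma>" and K: "is_subfield K" and t: "t \<in> K"
  shows "\<sigma> (per3_mult t) = per3_mult (\<sigma> t)"
proof -
  have in_K: "t ^ n \<in> K" "7 \<in> K" "7 * t \<in> K" "1 \<in> K" "t ^ 3 - t ^ 2 \<in> K" "t ^ 3 - t ^ 2 + 7 * t \<in> K" for n
    by (intro subfieldD(2,3,4,5)[OF K] subfield_power[OF K] subfield_numeral[OF K] t)+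
  have "\<sigma> 7 = 7" using field_autD(8)[OF \<sigma> K, of 7] by simp
  then show ?thesis
    unfolding per3_mult_def using in_K t by (simp add: field_autD[OF \<sigma> K])
qed

text \<open>\<open>A\<close> and \<open>B\<close> are fixed before \<open>s\<close>, so one pair
  serves both square roots of \<open>d\<close>; this allows \<open>t\<close> and \<open>- t\<close>
  to be compared.\<close>

lemma linear_power_over_subfield:
  assumes K: "is_subfield K" and D: "a \<in> K" "b \<in> K" "d \<in> K"
  shows "\<exists>A\<in>K. \<exists>B\<in>K. \<forall>s. s ^ 2 = d \<longrightarrow> (a + b * s) ^ n = A + B * s"
proof (induction n)
  case 0
  show ?case using subfieldD(1,2)[OF K] by (intro bexI[of _ 1] bexI[of _ 0]) auto
next
  case (Suc n)
  then obtain A B where AB: "A \<in> K" "B \<in> K" "\<And>s. s ^ 2 = d \<Longrightarrow> (a + b * s) ^ n = A + B * s" by blast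
  have "(a + b * s) ^ Suc n = (a * A + b * B * d) + (a * B + b * A) * s" if "s ^ 2 = d" for s
  proof -
    have "(a + b * s) ^ Suc n = (a + b * s) * (A + B * s)" by (simp add: AB(3)[OF that])
    also have "\<dots> = (a * A + b * B * s ^ 2) + (a * B + b * A) * s"
      by (simp add: algebra_simps power2_eq_square)
    finally show ?thesis by (simp add: that)
  qed
  moreover have "a * A + b * B * d \<in> K" "a * B + b * A \<in> K"
    using D AB by (auto intro!: subfieldD[OF K])
  ultimately show ?case by blast
qed

lemma norm_root_of_unity:
  fixes x :: complex
  assumes "x ^ k = 1" "k > 0"
  shows "norm x = 1"
proof -
  have "norm x ^ k = 1" using assms(1) by (metis norm_one norm_power)
  then show ?thesis using assms(2) power_eq_1_iff[of "norm x" k] by simp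
qed

text \<open>If \<open>t\<close> were quadratic over \<open>K\<close>, its conjugate \<open>-t\<close> would give a second multiplier of absolute
  value 1 for the same parameter.\<close>

lemma param_in_subfield:
  assumes K: "is_subfield K" and z: "z \<in> K" and t: "t ^ 2 = - 7 - z"
    and x: "(8 + z - t * z) ^ k = 1" and k: "k > 0"
  shows "t \<in> K"
proof (rule ccontr)
  assume tK: "t \<notin> K"
  have inK: "8 + z \<in> K" "- z \<in> K" "- 7 - z \<in> K"
    using z subfield_numeral[OF K] subfieldD(3,4,6)[OF K] by blast+
  obtain A B where A: "A \<in> K" "B \<in> K"
    and AB: "\<And>s. s ^ 2 = - 7 - z \<Longrightarrow> (8 + z + - z * s) ^ k = A + B * s"
    using linear_power_over_subfield[OF K inK] by blast
  have 1: "A + B * t = 1" using AB[OF t] x by (simp add: mult.commute)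
  have B0: "B = 0"
  proof (rule ccontr)
    assume "B \<noteq> 0"
    then have "t = (1 - A) / B" using 1 by (simp add: field_simps)
    then show False using tK A subfieldD(2,4,8)[OF K] by metis
  qed
  \<comment> \<open>With \<open>B = 0\<close> the expansion takes the same value
    \<open>A = 1\<close> at \<open>- t\<close> as at \<open>t\<close>.\<close>
  have "(8 + z + t * z) ^ k = 1"
    using AB[of "- t"] t 1 B0 by (simp add: mult.commute)
  then have "norm (8 + z - t * z) = 1" "norm (8 + z + t * z) = 1"
    using x k norm_root_of_unity by blast+
  moreover have "(8 + z - t * z) + (8 + z + t * z) = 16 + 2 * z" by simp
  moreover have "(8 + z - t * z) * (8 + z + t * z) = (8 + z) ^ 2 + (7 + z) * z ^ 2"
  proof -
    have "(8 + z - t * z) * (8 + z + t * z) = (8 + z) ^ 2 - t ^ 2 * z ^ 2"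
      by (simp add: algebra_simps power2_eq_square)
    then show ?thesis unfolding t by (simp add: algebra_simps)
  qed
  ultimately have "z = - 7" by (rule both_mults_unimodular)
  then have "t = 0" using t by simp
  then show False using tK subfieldD(1)[OF K] by simp
qed

text \<open>Automorphisms preserve the hypotheses on \<open>t\<close>, so the estimates hold at
  every conjugate, while a nonzero algebraic integer has a conjugate of norm at least 1. The first
  use forces \<open>t + cnj t = 1\<close>; the second meets an element already known to be
  nonzero.\<close>

lemma per3_mult_not_root_of_unity:
  assumes fab: "finite_abelian_ext K" and t: "t \<in> K"
    and root: "per3_mult t ^ k = 1" "k > 0" and ne1: "per3_mult t \<noteq> 1"
  shows False
proof -
  have K: "is_subfield K" using fab by (simp add: finite_abelian_ext_def)
  have xK: "per3_mult t \<in> K" unfolding per3_mult_def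
    by (intro subfieldD(2,3,4,5)[OF K] subfield_power[OF K] subfield_numeral[OF K] t)
  have cK: "cnj t \<in> K" using cnj_in_finite_abelian_ext[OF fab t] .
  have int: "algebraic_int t" "algebraic_int (cnj t)"
    using algebraic_int_per3_mult_preimage algebraic_int_of_root_of_unity[OF root] by auto
  have conj: "norm (per3_mult (\<sigma> t)) = 1" "per3_mult (\<sigma> t) \<noteq> 1" "\<sigma> (cnj t) = cnj (\<sigma> t)"
    if \<sigma>: "field_aut K \<sigma>" for \<sigma>
  proof -
    note eq = field_aut_per3_mult[OF \<sigma> K t]
    have "per3_mult (\<sigma> t) ^ k = 1"
      using field_autD(7)[OF \<sigma> K xK, of k] field_autD(2)[OF \<sigma> K] root eq by simp
    then show "norm (per3_mult (\<sigma> t)) = 1" using norm_root_of_unity root(2) by blast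
    show "per3_mult (\<sigma> t) \<noteq> 1"
      using field_autD(9)[OF \<sigma> K xK subfieldD(2)[OF K]] field_autD(2)[OF \<sigma> K] ne1 eq by metis
    show "\<sigma> (cnj t) = cnj (\<sigma> t)" using field_aut_commutes_cnj[OF fab \<sigma> t] .
  qed
  have sK: "t + cnj t \<in> K" "t + cnj t - 1 \<in> K" "t * (t + cnj t - 1) \<in> K"
    by (intro subfieldD(2,3,4,5)[OF K] t cK)+
  have "t * (t + cnj t - 1) = 0"
  proof (rule ccontr)
    assume nz: "t * (t + cnj t - 1) \<noteq> 0"
    have "algebraic_int (t * (t + cnj t - 1))"
      by (intro algebraic_int_times algebraic_int_diff algebraic_int_plus int) auto
    then obtain \<sigma> where \<sigma>: "field_aut K \<sigma>" "norm (\<sigma> (t * (t + cnj t - 1))) \<ge> 1"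
      using algebraic_int_large_conjugate[OF fab sK(3) nz] by blast
    have "\<sigma> (t * (t + cnj t - 1)) = \<sigma> t * (\<sigma> t + cnj (\<sigma> t) - 1)"
      using t cK sK subfieldD(2)[OF K] by (simp add: field_autD[OF \<sigma>(1) K] conj(3)[OF \<sigma>(1)])
    then show False using \<sigma>(2) unimodular_mult_small[OF conj(1)[OF \<sigma>(1)]] by simp
  qed
  moreover have "t \<noteq> 0" using ne1 by (auto simp: per3_mult_def)
  ultimately have half: "t + cnj t = 1" by simp
  have mK: "t * cnj t \<in> K" "7 - t * cnj t \<in> K"
    by (intro subfieldD(4,5)[OF K] subfield_numeral[OF K] t cK)+
  \<comment> \<open>The identity automorphism specializes the facts \<open>conj\<close> to
    \<open>t\<close> itself.\<close>
  have id: "field_aut K (\<lambda>x. x)" by (simp add: field_aut_def bij_betw_def)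
  have "7 - t * cnj t \<noteq> 0"
    using unimodular_mult_Re_half(2)[OF conj(1,2)[OF id] half] .
  moreover have "algebraic_int (7 - t * cnj t)"
    by (intro algebraic_int_times algebraic_int_diff int) auto
  ultimately obtain \<sigma> where \<sigma>: "field_aut K \<sigma>" "norm (\<sigma> (7 - t * cnj t)) \<ge> 1"
    using algebraic_int_large_conjugate[OF fab mK(2)] by blast
  have "\<sigma> t + cnj (\<sigma> t) = 1"
    using field_autD(4)[OF \<sigma>(1) K t cK] conj(3)[OF \<sigma>(1)] half field_autD(2)[OF \<sigma>(1) K] by simp
  moreover have "\<sigma> (7 - t * cnj t) = 7 - \<sigma> t * cnj (\<sigma> t)"
    using t cK mK subfield_numeral[OF K] field_autD(8)[OF \<sigma>(1) K, of 7]
    by (simp add: field_autD[OF \<sigma>(1) K] conj(3)[OF \<sigma>(1)])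
  ultimately show False
    using \<sigma>(2) unimodular_mult_Re_half(1)[OF conj(1,2)[OF \<sigma>(1)]] by simp
qed

theorem theorem4p3:
  fixes k :: nat and z :: complex
  assumes "k \<ge> 2" and "z \<in> Qab"
  shows "poly (Delta_tilde k) z \<noteq> 0"
proof
  assume "poly (Delta_tilde k) z = 0"
  then obtain j where j: "coprime j k"
    "poly [:64 + 16*z + 8*z^2 + z^3, -16 - 2*z, 1:] (cis (2 * pi * real j / real k)) = 0"
    using Delta_tilde_rootD[of k z] assms(1) by auto
  let ?x = "cis (2 * pi * real j / real k)"
  have x: "?x ^ k = 1" "?x \<noteq> 1" using cis_coprime_root[OF assms(1) j(1)] .
  obtain t where t: "t ^ 2 = - 7 - z" "?x = 8 + z - t * z"
    using delta3_rational_param[OF j(2)] by auto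
  obtain K where K: "finite_abelian_ext K" "z \<in> K" using assms(2) by (auto simp: Qab_def)
  \<comment> \<open>A square root of \<open>- 7 - z\<close> need not lie in \<open>K\<close> in
    general; here it does because the multiplier is a root of unity.\<close>
  have "t \<in> K"
    using param_in_subfield[of K z t k] K t x(1) assms(1) by (simp add: finite_abelian_ext_def)
  have z: "z = - 7 - t ^ 2" using t(1) by simp
  have eq: "?x = per3_mult t"
    unfolding t(2) by (simp add: z per3_mult_def algebra_simps power2_eq_square power3_eq_cube)
  then show False
    using per3_mult_not_root_of_unity[OF K(1) \<open>t \<in> K\<close>, of k] x[unfolded eq] assms(1) by auto
qed

end
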